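(* Let $G=([n],E)$ be a directed acyclic graph with weights $w\in\mathbb{R}^E$ (nodes labeled so that $j\to i\in E$ implies $j<i$), with weighted adjacency matrix $C$. Then $\mathrm{Q}(C)=\mathrm{Q}(C^\flat)$, and the weighted transitive reduction $G^\flat_w$ is the unique minimal (with respect to inclusion of edge sets) weighted DAG with this property, while $w^\flat$ are the unique weights on $G^\flat_w$ such that the corresponding weighted digraph polyhedron coincides with $\mathrm{Q}(C)$.
   Context: Min-plus conventions: $\mathbb{T}=\mathbb{R}\cup\{\infty\}$. The weighted adjacency matrix of a weighted DAG $(G,w)$ on $[n]$ is $C\in\mathbb{T}^{n\times n}$ with $c_{ij}=w(j\to i)$ if $j\to i$ is an edge, $c_{ii}=0$, and $c_{ij}=\infty$ otherwise. The weighted digraph polyhedron is $\mathrm{Q}(C)=\{x\in\mathbb{R}^n/\mathbb{R}\mathbf{1} : x_i-x_j\le c_{ij}\text{ for all }i\neq j\}$. The weighted transitive reduction $G^\flat_w$ is the subgraph of $G$ containing the edge $j\to i$ (with weight $w(j\to i)$) exactly when the one-edge path $j\to i$ is the unique shortest (minimum total weight) directed path from $j$ to $i$ in $G$; $w^\flat=w|_{G^\flat_w}$ and $C^\flat$ is the weighted adjacency matrix of $(G^\flat_w,w^\flat)$. *)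

theory Defs
  imports "HOL-Analysis.Analysis" "Graph_Theory.Pair_Digraph"
begin

text \<open>
  The node set $[n]$ is an arbitrary finite linearly ordered type \<open>'n\<close>, and an edge $j \to i$ is
  the pair \<open>(j, i)\<close>. Weight vectors in $\mathbb{R}^E$ are functions in \<open>E \<rightarrow>\<^sub>E UNIV\<close>, i.e. with
  a fixed junk value outside \<open>E\<close>, so that equality of weights on \<open>E\<close> is equality in HOL.
\<close>

definition weighted_dag :: "('n \<times> 'n) set \<Rightarrow> ('n \<times> 'n \<Rightarrow> real) \<Rightarrow> bool" where
  "weighted_dag E w \<longleftrightarrow> acyclic E \<and> w \<in> E \<rightarrow>\<^sub>E UNIV"

text \<open>
  Min-plus matrices are \<open>ereal\<close> matrices; the value \<open>-\<infinity>\<close> never occurs below.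
  Note the transposition: entry $c_{ij}$ belongs to the edge $j \to i$. The order of the cases is
  irrelevant for acyclic graphs, which have no loops.
\<close>

definition weighted_adjacency ::
  "('n::finite \<times> 'n) set \<Rightarrow> ('n \<times> 'n \<Rightarrow> real) \<Rightarrow> ereal ^ 'n ^ 'n" where
  "weighted_adjacency E w =
     (\<chi> i j. if (j, i) \<in> E then ereal (w (j, i)) else if i = j then 0 else \<infinity>)"

text \<open>Elements of $\mathbb{R}^n/\mathbb{R}\mathbf{1}$ are classes of this equivalence.\<close>

definition mod_ones :: "(real ^ 'n::finite) rel" where
  "mod_ones = {(x, y). \<exists>t::real. y - x = t *\<^sub>R 1}"

lemma equiv_mod_ones: "equiv UNIV mod_ones"
proof (rule equivI)
  show "refl mod_ones"
    by (auto simp: refl_on_def mod_ones_def intro: exI[of _ 0])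
  show "sym mod_ones"
    unfolding sym_def mod_ones_def
    by (auto, metis minus_diff_eq scaleR_minus_left)
  show "trans mod_ones"
  proof (rule transI)
    fix x y z :: "real ^ 'n"
    assume "(x, y) \<in> mod_ones" "(y, z) \<in> mod_ones"
    then obtain s t where "y - x = s *\<^sub>R 1" "z - y = t *\<^sub>R 1"
      by (auto simp: mod_ones_def)
    then have "z - x = (s + t) *\<^sub>R 1"
      by (simp add: scaleR_left_distrib flip: \<open>y - x = s *\<^sub>R 1\<close> \<open>z - y = t *\<^sub>R 1\<close>)
    then show "(x, z) \<in> mod_ones"
      by (auto simp: mod_ones_def)
  qed
qed simp

text \<open>The defining inequalities are invariant under \<^const>\<open>mod_ones\<close>.\<close>

definition wd_polyhedron :: "ereal ^ 'n ^ 'n \<Rightarrow> (real ^ 'n::finite) set set" where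
  "wd_polyhedron C = {x. \<forall>i j. i \<noteq> j \<longrightarrow> ereal (x $ i - x $ j) \<le> C $ i $ j} // mod_ones"

definition shortest_path ::
  "('n \<times> 'n) set \<Rightarrow> ('n \<times> 'n \<Rightarrow> real) \<Rightarrow> 'n \<Rightarrow> ('n \<times> 'n) list \<Rightarrow> 'n \<Rightarrow> bool" where
  "shortest_path E w j p i \<longleftrightarrow>
     is_arg_min (\<lambda>q. sum_list (map w q))
       (\<lambda>q. pre_digraph.apath (with_proj \<lparr>pverts = UNIV, parcs = E\<rparr>) j q i) p"

definition reduction_edges ::
  "('n \<times> 'n) set \<Rightarrow> ('n \<times> 'n \<Rightarrow> real) \<Rightarrow> ('n \<times> 'n) set" where
  "reduction_edges E w = {(j, i) \<in> E. {p. shortest_path E w j p i} = {[(j, i)]}}"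

definition reduction_weights ::
  "('n \<times> 'n) set \<Rightarrow> ('n \<times> 'n \<Rightarrow> real) \<Rightarrow> ('n \<times> 'n \<Rightarrow> real)" where
  "reduction_weights E w = restrict w (reduction_edges E w)"

definition dag_presents ::
  "('n::finite \<times> 'n) set \<Rightarrow> ('n \<times> 'n \<Rightarrow> real) \<Rightarrow> (real ^ 'n) set set \<Rightarrow> bool" where
  "dag_presents E w P \<longleftrightarrow> weighted_dag E w \<and> wd_polyhedron (weighted_adjacency E w) = P"

text \<open>
  Minimality compares edge sets only, whatever the weights. The competing graphs are arbitrary
  weighted DAGs on the node set; they need not be compatible with its linear order.
\<close>

definition minimal_dag_presents ::
  "('n::finite \<times> 'n) set \<Rightarrow> ('n \<times> 'n \<Rightarrow> real) \<Rightarrow> (real ^ 'n) set set \<Rightarrow> bool" where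
  "minimal_dag_presents E w P \<longleftrightarrow>
     dag_presents E w P \<and> (\<forall>E' w'. dag_presents E' w' P \<longrightarrow> \<not> E' \<subset> E)"

end

theory Submission
  imports Defs
begin

text \<open>
  An edge \<open>(j, i)\<close> outside the reduction is dominated by another walk from \<open>j\<close> to \<open>i\<close>, all of whose
  edges span strictly smaller intervals of the node order; by induction its inequality is implied
  by those of the reduction. Conversely, for an edge \<open>(j, i)\<close> of the reduction some point of the
  polyhedron is tight on \<open>(j, i)\<close> and on no other edge. Moving this point in suitable coordinate
  directions shows that any presentation of the polyhedron must have \<open>(j, i)\<close>, with the same
  weight, as its only tight constraint there. Hence every presenting DAG contains the reduction
  and agrees with it in the weights, which gives minimality and both uniqueness claims.
\<close>

section \<open>Feasible points and walks\<close>

text \<open>The polyhedron before passing to the quotient, with real inequalities indexed by edges.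
  A loop contributes a constraint here but not in \<open>wd_polyhedron\<close>, so the two are
  compared for irreflexive edge sets.\<close>

definition feasible :: "('n \<times> 'n) set \<Rightarrow> ('n \<times> 'n \<Rightarrow> real) \<Rightarrow> (real ^ 'n::finite) set" where
  "feasible E w = {x. \<forall>(a, b) \<in> E. x $ b - x $ a \<le> w (a, b)}"

definition walk :: "('n \<times> 'n) set \<Rightarrow> 'n \<Rightarrow> ('n \<times> 'n) list \<Rightarrow> 'n \<Rightarrow> bool" where
  "walk E u p v \<longleftrightarrow> set p \<subseteq> E \<and> pcas u p v"

lemma walk_simps [simp]:
  "walk E u [] v \<longleftrightarrow> u = v"
  "walk E u (e # p) v \<longleftrightarrow> e \<in> E \<and> fst e = u \<and> walk E (snd e) p v"
  by (auto simp: walk_def)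

lemma walk_snoc: "walk E u p v \<Longrightarrow> (v, b) \<in> E \<Longrightarrow> walk E u (p @ [(v, b)]) b"
  by (induction p arbitrary: u) auto

lemma walk_feasible:
  fixes x :: "real ^ 'n::finite"
  assumes "walk E u p v" "\<And>a b. (a, b) \<in> set p \<Longrightarrow> x $ b - x $ a \<le> w (a, b)"
  shows "x $ v - x $ u \<le> sum_list (map w p)"
  using assms
proof (induction p arbitrary: u)
  case (Cons e p)
  then have "x $ v - x $ snd e \<le> sum_list (map w p)" "x $ snd e - x $ u \<le> w e"
    by (cases e; auto)+
  then show ?case by simp
qed simp

section \<open>Walks along edges that increase in the node order\<close>

context
  fixes E :: "('n::{finite,linorder} \<times> 'n) set"
  assumes increasing: "\<And>j i. (j, i) \<in> E \<Longrightarrow> j < i"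
begin

lemma walk_mono: "walk E u p v \<Longrightarrow> u \<le> v"
  by (induction p arbitrary: u) (auto dest!: increasing intro: order.trans[OF less_imp_le])

lemma walk_strict_mono: "walk E u p v \<Longrightarrow> p \<noteq> [] \<Longrightarrow> u < v"
  by (cases p) (auto dest!: increasing walk_mono)

lemma walk_mem_bounds: "walk E u p v \<Longrightarrow> (a, b) \<in> set p \<Longrightarrow> u \<le> a \<and> b \<le> v"
proof (induction p arbitrary: u)
  case (Cons e p)
  then show ?case
    using walk_mono[of "snd e" p v] increasing[of "fst e" "snd e"] by fastforce
qed simp

text \<open>After its first edge the walk has left \<open>u\<close> for good, so
  \<open>(u, v)\<close> must come first; the rest then runs from \<open>v\<close> to
  \<open>v\<close> and is empty.\<close>

lemma walk_mem_ends:
  assumes "walk E u p v" "(u, v) \<in> set p"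
  shows "p = [(u, v)]"
proof (cases p)
  case (Cons e q)
  have "(u, v) \<notin> set q"
    using assms walk_mem_bounds[of "snd e" q v u v] increasing[of u "snd e"] Cons
    by (cases e) fastforce
  then have "e = (u, v)" using assms Cons by simp
  then show ?thesis using assms Cons walk_strict_mono[of v q v] by auto
qed (use assms in simp)

lemma pawalk_verts_ge: "walk E u p v \<Longrightarrow> x \<in> set (pawalk_verts u p) \<Longrightarrow> u \<le> x"
proof (induction p arbitrary: u)
  case (Cons e p)
  then show ?case using increasing[of "fst e" "snd e"] by fastforce
qed simp

lemma distinct_pawalk_verts: "walk E u p v \<Longrightarrow> distinct (pawalk_verts u p)"
proof (induction p arbitrary: u)
  case (Cons e p)
  then show ?case
    using pawalk_verts_ge[of "snd e" p v "fst e"] increasing[of "fst e" "snd e"] by auto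
qed simp

text \<open>Nodes strictly increase along a walk, so none repeats. This replaces paths by walks,
  which can be extended freely.\<close>

lemma apath_iff_walk:
  "pre_digraph.apath (with_proj \<lparr>pverts = UNIV, parcs = E\<rparr>) u p v \<longleftrightarrow> walk E u p v"
  using distinct_pawalk_verts[of u p v]
  by (auto simp: pre_digraph.apath_def pre_digraph.awalk_def walk_def
      cas_with_proj_eq awalk_verts_with_proj_eq)

lemma finite_walks: "finite {(u, p, v). walk E u p v}"
proof -
  interpret pair_fin_digraph "\<lparr>pverts = UNIV, parcs = E\<rparr>"
    by unfold_locales auto
  show ?thesis using apaths_finite_triple unfolding apath_iff_walk .
qed

section \<open>The reduction and its feasible points\<close>

text \<open>A walk \<open>q\<close> that is not a minimiser is strictly beaten by some
  \<open>r\<close>, and the edge is at most as long as \<open>r\<close>. Uniqueness of the minimiser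
  thus becomes a strict inequality.\<close>

lemma reduction_edges_iff:
  "(j, i) \<in> reduction_edges E w \<longleftrightarrow>
     (j, i) \<in> E \<and> (\<forall>q. walk E j q i \<longrightarrow> q \<noteq> [(j, i)] \<longrightarrow> w (j, i) < sum_list (map w q))"
proof -
  have "{p. shortest_path E w j p i} = {[(j, i)]} \<longleftrightarrow>
      (\<forall>q. walk E j q i \<longrightarrow> q \<noteq> [(j, i)] \<longrightarrow> w (j, i) < sum_list (map w q))" (is "?L \<longleftrightarrow> ?R")
    if "(j, i) \<in> E"
  proof
    assume L: ?L
    then have "is_arg_min (\<lambda>q. sum_list (map w q)) (\<lambda>q. walk E j q i) [(j, i)]"
      unfolding shortest_path_def apath_iff_walk by blast
    then have min: "w (j, i) \<le> sum_list (map w q)" if "walk E j q i" for q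
      using that by (auto simp: is_arg_min_linorder)
    show ?R
    proof (intro allI impI)
      fix q assume q: "walk E j q i" "q \<noteq> [(j, i)]"
      then have "\<not> shortest_path E w j q i" using L by blast
      then obtain r where "walk E j r i" "sum_list (map w r) < sum_list (map w q)"
        using q(1) unfolding shortest_path_def apath_iff_walk is_arg_min_def by blast
      then show "w (j, i) < sum_list (map w q)" using min by fastforce
    qed
  next
    assume R: ?R
    have "walk E j [(j, i)] i" using that by simp
    with R show ?L
      unfolding shortest_path_def apath_iff_walk is_arg_min_def
      by (auto simp: not_less) (fastforce dest: spec[of _ "[(j, i)]"])
  qed
  then show ?thesis by (auto simp: reduction_edges_def)
qed

lemma feasible_reduction:
  "feasible (reduction_edges E w) (reduction_weights E w) = feasible E w"
proof
  show "feasible E w \<subseteq> feasible (reduction_edges E w) (reduction_weights E w)"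
    by (auto simp: feasible_def reduction_weights_def reduction_edges_def)
  show "feasible (reduction_edges E w) (reduction_weights E w) \<subseteq> feasible E w"
  proof
    fix x assume x: "x \<in> feasible (reduction_edges E w) (reduction_weights E w)"
    have "x $ i - x $ j \<le> w (j, i)" if "(j, i) \<in> E" for j i
      using that
    proof (induction "card {j..i}" arbitrary: j i rule: less_induct)
      case less
      show ?case
      proof (cases "(j, i) \<in> reduction_edges E w")
        case True
        then show ?thesis using x by (auto simp: feasible_def reduction_weights_def)
      next
        case False
        \<comment> \<open>Ties also exclude an edge from the reduction, hence \<open>\<le>\<close>,
          which is all the bound on \<open>x $ i - x $ j\<close> needs.\<close>
        then obtain q where q: "walk E j q i" "q \<noteq> [(j, i)]" "sum_list (map w q) \<le> w (j, i)"
          using less.prems by (auto simp: reduction_edges_iff not_less)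
        have "x $ b - x $ a \<le> w (a, b)" if ab: "(a, b) \<in> set q" for a b
        proof (rule less.hyps)
          show "(a, b) \<in> E" using q(1) ab by (auto simp: walk_def)
          have "j \<le> a" "b \<le> i" using walk_mem_bounds[OF q(1) ab] by auto
          moreover have "(a, b) \<noteq> (j, i)" using walk_mem_ends[OF q(1)] q(2) ab by auto
          moreover have "j < i" using increasing less.prems .
          ultimately have "{a..b} \<subset> {j..i}" by auto
          then show "card {a..b} < card {j..i}" by (simp add: psubset_card_mono)
        qed
        then show ?thesis using walk_feasible[OF q(1)] q(3) by fastforce
      qed
    qed
    then show "x \<in> feasible E w" by (auto simp: feasible_def)
  qed
qed

text \<open>
  The witness assigns to \<open>k\<close> the least length of a walk ending in \<open>k\<close>, for weights lowered
  by a small \<open>\<delta>\<close> off the edge \<open>(j, i)\<close>, where walks not starting in \<open>j\<close> carry a large penalty \<open>M\<close>.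
\<close>

lemma exists_point_tight_on_single_edge:
  assumes "(j, i) \<in> reduction_edges E w"
  obtains x :: "(real, 'n) vec" where "x $ i - x $ j = w (j, i)"
    "\<And>a b. (a, b) \<in> E \<Longrightarrow> (a, b) \<noteq> (j, i) \<Longrightarrow> x $ b - x $ a < w (a, b)"
proof -
  have ji: "(j, i) \<in> E" and
    short: "\<And>q. walk E j q i \<Longrightarrow> q \<noteq> [(j, i)] \<Longrightarrow> w (j, i) < sum_list (map w q)"
    using assms by (auto simp: reduction_edges_iff)
  define Q where "Q = {q. walk E j q i \<and> q \<noteq> [(j, i)]}"
  have "Q \<subseteq> (fst \<circ> snd) ` {(u, p, v). walk E u p v}"
    by (force simp: Q_def)
  then have finQ: "finite Q" using finite_walks finite_surj by blast
  \<comment> \<open>There are finitely many competing walks, each strictly longer than the edge, so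
    one small positive \<open>d\<close> leaves all of them longer after lowering.\<close>
  have "\<forall>\<^sub>F d in at_right (0::real). \<forall>q\<in>Q. w (j, i) < sum_list (map w q) - d * real (length q)"
  proof (intro eventually_ball_finite finQ ballI)
    fix q assume "q \<in> Q"
    then have "w (j, i) < sum_list (map w q)" using short by (auto simp: Q_def)
    moreover have "((\<lambda>d. sum_list (map w q) - d * real (length q)) \<longlongrightarrow> sum_list (map w q) - 0 * real (length q))
        (at_right 0)" by (intro tendsto_intros)
    ultimately show "\<forall>\<^sub>F d in at_right 0. w (j, i) < sum_list (map w q) - d * real (length q)"
      by (intro order_tendstoD(1)) auto
  qed
  then have "\<forall>\<^sub>F d in at_right (0::real). 0 < d \<and>
      (\<forall>q\<in>Q. w (j, i) < sum_list (map w q) - d * real (length q))"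
    by (intro eventually_conj) (auto simp: eventually_at_right_less)
  then obtain d :: real where d: "0 < d"
    "\<And>q. q \<in> Q \<Longrightarrow> w (j, i) < sum_list (map w q) - d * real (length q)"
    using eventually_happens'[OF trivial_limit_at_right_real] by blast
  define w' where "w' e = (if e = (j, i) then w e else w e - d)" for e
  define len where "len p = sum_list (map w' p)" for p
  have len_ge: "sum_list (map w p) - d * length p \<le> len p" for p
    unfolding len_def w'_def using d(1) by (induction p) (auto simp: algebra_simps)
  define W where "W = {(u, p, v). walk E u p v}"
  \<comment> \<open>Summing over all walks makes \<open>M\<close> large enough that any penalised
    walk has length at least \<open>0\<close> and at least \<open>w (j, i)\<close>.\<close>
  define M where "M = \<bar>w (j, i)\<bar> + (\<Sum>(u, p, v)\<in>W. \<bar>len p\<bar>)"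
  have M: "0 \<le> M + len p" "w (j, i) \<le> M + len p" if "walk E u p v" for u p v
  proof -
    have "\<bar>len p\<bar> \<le> (\<Sum>(u, p, v)\<in>W. \<bar>len p\<bar>)"
      using member_le_sum[of "(u, p, v)" W "\<lambda>(u, p, v). \<bar>len p\<bar>"] that finite_walks
      by (auto simp: W_def)
    then show "0 \<le> M + len p" "w (j, i) \<le> M + len p" unfolding M_def by linarith+
  qed
  define f where "f = (\<lambda>(u, p). (if u = j then 0 else M) + len p)"
  \<comment> \<open>The start node is kept with the walk because an empty list does not determine
    it.\<close>
  define V where "V k = {(u, p). walk E u p k}" for k
  have finV: "finite (V k)" for k
    using finite_surj[OF finite_walks, of "V k" "\<lambda>(u, p, v). (u, p)"]
    by (force simp: V_def)
  have neV: "V k \<noteq> {}" for k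
    by (auto simp: V_def intro!: exI[of _ k] exI[of _ "[]"])
  define x :: "(real, 'n) vec" where "x = (\<chi> k. Min (f ` V k))"
  have x_le: "x $ k \<le> f (u, p)" if "walk E u p k" for u p k
    using that finV by (auto simp: x_def V_def intro!: Min_le)
  have x_ge: "c \<le> x $ k" if "\<And>u p. walk E u p k \<Longrightarrow> c \<le> f (u, p)" for c k
    using that finV neV by (auto simp: x_def V_def)
  have edge: "x $ b - x $ a \<le> w' (a, b)" if ab: "(a, b) \<in> E" for a b
  proof -
    \<comment> \<open>Triangle inequality for least lengths: a walk to \<open>a\<close> extends by
      the edge to a walk to \<open>b\<close> with the same start, hence the same penalty.\<close>
    have "x $ b - w' (a, b) \<le> x $ a"
    proof (rule x_ge)
      fix u p assume "walk E u p a"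
      from x_le[OF walk_snoc[OF this ab]] show "x $ b - w' (a, b) \<le> f (u, p)"
        by (simp add: f_def len_def algebra_simps)
    qed
    then show ?thesis by simp
  qed
  have xj: "x $ j = 0"
  proof (rule antisym)
    show "x $ j \<le> 0" using x_le[of j "[]" j] by (simp add: f_def len_def)
    show "0 \<le> x $ j"
    proof (rule x_ge)
      fix u p assume "walk E u p j"
      then show "0 \<le> f (u, p)"
        \<comment> \<open>The only walk from \<open>j\<close> to itself is empty, of length
          \<open>0\<close>; every other walk ending in \<open>j\<close> is penalised.\<close>
        using M walk_strict_mono[of j p j] by (cases "p = []") (auto simp: f_def len_def)
    qed
  qed
  have xi: "x $ i = w (j, i)"
  proof (rule antisym)
    show "x $ i \<le> w (j, i)" using x_le[of j "[(j, i)]" i] ji by (simp add: f_def len_def w'_def)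
    show "w (j, i) \<le> x $ i"
    proof (rule x_ge)
      fix u p assume up: "walk E u p i"
      show "w (j, i) \<le> f (u, p)"
      \<comment> \<open>Competitors from \<open>j\<close> are controlled by the choice of
        \<open>d\<close>, the edge itself has its original weight, and all other walks are
        controlled by \<open>M\<close>.\<close>
      proof (cases "u = j \<and> p \<noteq> [(j, i)]")
        case True
        then show ?thesis using d(2)[of p] len_ge[of p] up by (auto simp: f_def Q_def)
      next
        case False
        then show ?thesis using M[OF up] by (auto simp: f_def len_def w'_def)
      qed
    qed
  qed
  show ?thesis
  proof
    show "x $ i - x $ j = w (j, i)" using xi xj by simp
    show "x $ b - x $ a < w (a, b)" if "(a, b) \<in> E" "(a, b) \<noteq> (j, i)" for a b
      using edge[OF that(1)] that(2) d(1) by (auto simp: w'_def)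
  qed
qed

end

section \<open>Perturbing a point tight on a single edge\<close>

text \<open>Slack constraints survive a small move by continuity, tight ones because
  \<open>y\<close> does not increase their left-hand side; finitely many constraints admit a common
  \<open>t\<close>.\<close>

lemma feasible_perturb:
  fixes x y :: "real ^ 'n::finite"
  assumes x: "x \<in> feasible E w"
    and tight: "\<And>a b. (a, b) \<in> E \<Longrightarrow> x $ b - x $ a = w (a, b) \<Longrightarrow> y $ b \<le> y $ a"
  obtains t where "0 < t" "x + t *\<^sub>R y \<in> feasible E w"
proof -
  have "\<forall>\<^sub>F t in at_right 0. \<forall>e\<in>E. (x + t *\<^sub>R y) $ snd e - (x + t *\<^sub>R y) $ fst e \<le> w e"
  proof (intro eventually_ball_finite ballI)
    fix e assume e: "e \<in> E"
    have le: "x $ snd e - x $ fst e \<le> w e" using x e by (auto simp: feasible_def)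
    show "\<forall>\<^sub>F t in at_right 0. (x + t *\<^sub>R y) $ snd e - (x + t *\<^sub>R y) $ fst e \<le> w e"
    proof (cases "x $ snd e - x $ fst e = w e")
      case True
      then have "y $ snd e \<le> y $ fst e" using tight[of "fst e" "snd e"] e by simp
      then have "(x + t *\<^sub>R y) $ snd e - (x + t *\<^sub>R y) $ fst e \<le> w e" if "t > 0" for t
        using True mult_left_mono[of "y $ snd e" "y $ fst e" t] that by (simp add: algebra_simps)
      then show ?thesis by (auto intro: eventually_mono[OF eventually_at_right_less])
    next
      case False
      have "((\<lambda>t. (x + t *\<^sub>R y) $ snd e - (x + t *\<^sub>R y) $ fst e) \<longlongrightarrow>
          (x + 0 *\<^sub>R y) $ snd e - (x + 0 *\<^sub>R y) $ fst e) (at_right 0)"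
        by (intro tendsto_intros)
      then have "\<forall>\<^sub>F t in at_right 0. (x + t *\<^sub>R y) $ snd e - (x + t *\<^sub>R y) $ fst e < w e"
        by (rule order_tendstoD(2)) (use le False in auto)
      then show ?thesis by (rule eventually_mono) simp
    qed
  qed simp
  then have "\<forall>\<^sub>F t in at_right 0. 0 < t \<and>
      (\<forall>e\<in>E. (x + t *\<^sub>R y) $ snd e - (x + t *\<^sub>R y) $ fst e \<le> w e)"
    by (intro eventually_conj) (auto simp: eventually_at_right_less)
  then obtain t where "0 < t" "\<forall>e\<in>E. (x + t *\<^sub>R y) $ snd e - (x + t *\<^sub>R y) $ fst e \<le> w e"
    using eventually_happens'[OF trivial_limit_at_right_real] by blast
  then show ?thesis using that by (force simp: feasible_def)
qed

lemma reduction_edge_in_presentation: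
  fixes E :: "('n::{finite,linorder} \<times> 'n) set"
  assumes inc: "\<And>j i. (j, i) \<in> E \<Longrightarrow> j < i"
    and ji: "(j, i) \<in> reduction_edges E w"
    and H: "irrefl H" "feasible H v = feasible E w"
  shows "(j, i) \<in> H \<and> v (j, i) = w (j, i)"
proof -
  obtain x :: "(real, 'n) vec" where xji: "x $ i - x $ j = w (j, i)"
    and strict: "\<And>a b. (a, b) \<in> E \<Longrightarrow> (a, b) \<noteq> (j, i) \<Longrightarrow> x $ b - x $ a < w (a, b)"
    using exists_point_tight_on_single_edge[OF inc ji] by blast
  have E: "(j, i) \<in> E" using ji by (simp add: reduction_edges_def)
  then have "j \<noteq> i" using inc by blast
  have xE: "x \<in> feasible E w" using xji strict by (force simp: feasible_def)
  \<comment> \<open>As only \<open>(j, i)\<close> is tight at \<open>x\<close> in \<open>E\<close>,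
    a short move along \<open>y\<close> stays in the common feasible set and cannot violate a tight
    constraint of \<open>H\<close>.\<close>
  have tight: "y $ b \<le> y $ a"
    if ab: "(a, b) \<in> H" "x $ b - x $ a = v (a, b)" and y: "y $ i \<le> y $ j"
    for a b and y :: "(real, 'n) vec"
  proof (rule ccontr)
    assume "\<not> y $ b \<le> y $ a"
    obtain t where t: "0 < t" "x + t *\<^sub>R y \<in> feasible E w"
    proof (rule feasible_perturb[OF xE])
      show "y $ d \<le> y $ c" if "(c, d) \<in> E" "x $ d - x $ c = w (c, d)" for c d
        using strict[OF that(1)] that(2) y by fastforce
    qed
    then have "x + t *\<^sub>R y \<in> feasible H v" using H by simp
    then have "t * y $ b \<le> t * y $ a" using ab by (fastforce simp: feasible_def)
    then show False using t(1) \<open>\<not> y $ b \<le> y $ a\<close> by simp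
  qed
  have only: "(a, b) = (j, i)" if ab: "(a, b) \<in> H" "x $ b - x $ a = v (a, b)" for a b
  proof -
    have "a \<noteq> b" using ab H(1) by (auto simp: irrefl_def)
    have "b = i"
    proof (rule ccontr)
      assume "b \<noteq> i"
      then show False
        \<comment> \<open>Raising coordinate \<open>b\<close> alone does not increase
          \<open>x $ i - x $ j\<close> but would violate the constraint
          \<open>(a, b)\<close>.\<close>
        using tight[OF ab, of "axis b 1"] \<open>a \<noteq> b\<close> by (cases "j = b") (simp_all add: axis_def)
    qed
    moreover have "a = j"
    proof (rule ccontr)
      assume "a \<noteq> j"
      then show False
        \<comment> \<open>Lowering coordinate \<open>a\<close> alone leaves coordinates
          \<open>i\<close> and \<open>j\<close> fixed, since \<open>a\<close> differs from both, but
          would violate \<open>(a, b)\<close>.\<close>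
        using tight[OF ab, of "- axis a 1"] \<open>a \<noteq> b\<close> \<open>b = i\<close> by (simp add: axis_def)
    qed
    ultimately show ?thesis by simp
  qed
  have "(j, i) \<in> H \<and> x $ i - x $ j = v (j, i)"
  proof (rule ccontr)
    assume "\<not> ((j, i) \<in> H \<and> x $ i - x $ j = v (j, i))"
    then have no_tight: "x $ b - x $ a \<noteq> v (a, b)" if "(a, b) \<in> H" for a b
      using only that by blast
    \<comment> \<open>With no constraint of \<open>H\<close> tight, coordinate \<open>i\<close>
      could be raised within the feasible set, although \<open>(j, i)\<close> is tight in
      \<open>E\<close>.\<close>
    obtain t where t: "0 < t" "x + t *\<^sub>R axis i 1 \<in> feasible H v"
      by (rule feasible_perturb[of x H v "axis i 1"]) (use xE H(2) no_tight in auto)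
    then have "x + t *\<^sub>R axis i 1 \<in> feasible E w" using H by simp
    then have "(x + t *\<^sub>R axis i 1) $ i - (x + t *\<^sub>R axis i 1) $ j \<le> w (j, i)"
      using E by (auto simp: feasible_def)
    then show False using t(1) xji \<open>j \<noteq> i\<close> by (simp add: axis_def)
  qed
  then show ?thesis using xji by simp
qed

section \<open>From the quotient back to feasible points\<close>

lemma wd_polyhedron_eq_quotient:
  assumes "irrefl E"
  shows "wd_polyhedron (weighted_adjacency E w) = feasible E w // mod_ones"
proof -
  have "{x. \<forall>i j. i \<noteq> j \<longrightarrow> ereal (x $ i - x $ j) \<le> weighted_adjacency E w $ i $ j} = feasible E w"
    using assms by (auto simp: weighted_adjacency_def feasible_def irrefl_def)
  then show ?thesis by (simp add: wd_polyhedron_def)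
qed

text \<open>Differences of coordinates ignore a common shift, so the feasible set is a union of
  classes. Hence no information is lost in the quotient, and equal polyhedra have equal feasible
  sets.\<close>

lemma Union_feasible_quotient: "\<Union> (feasible E w // mod_ones) = feasible E w"
proof
  show "feasible E w \<subseteq> \<Union> (feasible E w // mod_ones)"
    using equiv_class_self[OF equiv_mod_ones] by (fastforce simp: quotient_def)
  show "\<Union> (feasible E w // mod_ones) \<subseteq> feasible E w"
  proof
    fix y assume "y \<in> \<Union> (feasible E w // mod_ones)"
    then obtain x t where x: "x \<in> feasible E w" "y - x = t *\<^sub>R 1"
      by (auto simp: quotient_def mod_ones_def)
    have "y $ k = x $ k + t" for k
      using arg_cong[OF x(2), of "\<lambda>z. z $ k"] by simp
    then show "y \<in> feasible E w" using x(1) by (simp add: feasible_def)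
  qed
qed

lemma wd_polyhedron_eq_iff:
  assumes "irrefl E" "irrefl H"
  shows "wd_polyhedron (weighted_adjacency H v) = wd_polyhedron (weighted_adjacency E w)
    \<longleftrightarrow> feasible H v = feasible E w"
  using assms by (metis wd_polyhedron_eq_quotient Union_feasible_quotient)

theorem theorem4p10:
  fixes E :: "('n::{finite,linorder} \<times> 'n) set" and w :: "'n \<times> 'n \<Rightarrow> real"
  assumes "weighted_dag E w"
    and "\<And>j i. (j, i) \<in> E \<Longrightarrow> j < i"
  shows "wd_polyhedron (weighted_adjacency E w)
         = wd_polyhedron (weighted_adjacency (reduction_edges E w) (reduction_weights E w))
       \<and> (\<forall>H v. minimal_dag_presents H v (wd_polyhedron (weighted_adjacency E w))
         \<longleftrightarrow> H = reduction_edges E w \<and> v = reduction_weights E w)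
       \<and> (\<forall>v \<in> reduction_edges E w \<rightarrow>\<^sub>E UNIV.
         wd_polyhedron (weighted_adjacency (reduction_edges E w) v)
           = wd_polyhedron (weighted_adjacency E w)
         \<longleftrightarrow> v = reduction_weights E w)"
proof -
  let ?F = "reduction_edges E w" and ?u = "reduction_weights E w"
  let ?P = "wd_polyhedron (weighted_adjacency E w)"
  have irrefl: "irrefl H" if "acyclic H" for H :: "('n \<times> 'n) set"
    using that by (auto simp: acyclic_def irrefl_def)
  have acE: "acyclic E" using assms(1) by (simp add: weighted_dag_def)
  have acF: "acyclic ?F"
    by (rule acyclic_subset[OF acE]) (auto simp: reduction_edges_def)
  have P: "wd_polyhedron (weighted_adjacency H v) = ?P \<longleftrightarrow> feasible H v = feasible E w"
    if "acyclic H" for H v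
    using wd_polyhedron_eq_iff[OF irrefl[OF acE] irrefl[OF that]] .
  have FP: "wd_polyhedron (weighted_adjacency ?F ?u) = ?P"
    using P[OF acF] feasible_reduction[OF assms(2)] by blast
  have presF: "dag_presents ?F ?u ?P"
    using FP acF by (auto simp: dag_presents_def weighted_dag_def reduction_weights_def)
  have key: "(j, i) \<in> H \<and> v (j, i) = w (j, i)"
    if "dag_presents H v ?P" "(j, i) \<in> ?F" for H v j i
  proof (rule reduction_edge_in_presentation[OF assms(2) that(2)])
    show "irrefl H" "feasible H v = feasible E w"
      using that(1) P irrefl by (auto simp: dag_presents_def weighted_dag_def)
  qed
  have weights: "v = ?u" if "dag_presents ?F v ?P" for v
  \<comment> \<open>Agreement on the edges comes from \<open>key\<close>; off the edges both
    functions take the same fixed junk value.\<close>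
  proof (rule extensionalityI[of v ?F])
    show "v \<in> extensional ?F"
      using that by (auto simp: dag_presents_def weighted_dag_def PiE_def)
    show "?u \<in> extensional ?F" by (simp add: reduction_weights_def)
    show "v e = ?u e" if "e \<in> ?F" for e
      using key[OF \<open>dag_presents ?F v ?P\<close>, of "fst e" "snd e"] that
      by (simp add: reduction_weights_def)
  qed
  have "minimal_dag_presents H v ?P \<longleftrightarrow> H = ?F \<and> v = ?u" for H v
  proof
    assume min: "minimal_dag_presents H v ?P"
    then have pres: "dag_presents H v ?P" by (simp add: minimal_dag_presents_def)
    then have "?F \<subseteq> H" using key by auto
    then have "H = ?F" using min presF by (auto simp: minimal_dag_presents_def)
    then show "H = ?F \<and> v = ?u" using weights pres by blast
  next
    assume "H = ?F \<and> v = ?u"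
    \<comment> \<open>Every presenting DAG contains the reduction, so none can be properly contained
      in it.\<close>
    moreover have "\<not> H' \<subset> ?F" if "dag_presents H' v' ?P" for H' v'
      using key[OF that] by auto
    ultimately show "minimal_dag_presents H v ?P"
      using presF by (auto simp: minimal_dag_presents_def)
  qed
  moreover have "wd_polyhedron (weighted_adjacency ?F v) = ?P \<longleftrightarrow> v = ?u"
    if "v \<in> ?F \<rightarrow>\<^sub>E UNIV" for v
    using weights[of v] FP acF that by (auto simp: dag_presents_def weighted_dag_def)
  ultimately show ?thesis using FP by simp
qed

end
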